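(* Let $s$ be a graphical sequence and $\xi$ an integer-valued graph parameter. If $\xi$ is stable under 2-switch, then $\xi$ has the interval property on $\mathcal{G}(s)$ and on $\mathcal{F}(s)$.
   Context: Graphs are finite, simple, undirected and labeled. For a graphical sequence $s=(d_1,\dots,d_n)$, $\mathcal{G}(s)$ is the set of graphs with vertex set $[n]$ in which vertex $i$ has degree $d_i$, and $\mathcal{F}(s)$ the set of forests in $\mathcal{G}(s)$. For $a,b,c,d$, the 2-switch $\tau=\binom{a\ b}{c\ d}$ maps a graph $G$ to $G-ab-cd+ac+bd$ if $ab,cd\in E(G)$, $\{a,b\}\cap\{c,d\}=\varnothing$ and $ac,bd\notin E(G)$, and to $G$ otherwise. A graph parameter $\xi$ is stable under 2-switch if $|\xi(\tau(G))-\xi(G)|\le 1$ for every graph $G$ and every 2-switch $\tau$. A parameter $\xi$ defined on a collection $\mathcal{X}$ of graphs has the interval property on $\mathcal{X}$ if $\xi(\mathcal{X})=I\cap\mathbb{Z}$ for some interval $I\subset\mathbb{R}$. *)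

theory Defs
  imports "HOL-Analysis.Analysis"
begin

record ugraph =
  verts :: "nat set"
  edges :: "nat set set"

definition simple_graph :: "ugraph \<Rightarrow> bool" where
  "simple_graph G \<longleftrightarrow>
     finite (verts G) \<and> (\<forall>e \<in> edges G. e \<subseteq> verts G \<and> card e = 2)"

definition degree :: "ugraph \<Rightarrow> nat \<Rightarrow> nat" where
  "degree G v = card {e \<in> edges G. v \<in> e}"

definition is_cycle :: "ugraph \<Rightarrow> nat list \<Rightarrow> bool" where
  "is_cycle G vs \<longleftrightarrow>
     length vs \<ge> 3 \<and> distinct vs \<and>
     (\<forall>i < length vs. {vs ! i, vs ! (Suc i mod length vs)} \<in> edges G)"

definition forest :: "ugraph \<Rightarrow> bool" where
  "forest G \<longleftrightarrow> simple_graph G \<and> (\<nexists>vs. is_cycle G vs)"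

text \<open>Vertices are numbered from 1, list positions from 0, so the degree
  prescribed for vertex i is the list entry at position i - 1.\<close>

definition graphs_with_degrees :: "nat list \<Rightarrow> ugraph set" where
  "graphs_with_degrees s =
     {G. simple_graph G \<and> verts G = {1..length s} \<and>
         (\<forall>i \<in> {1..length s}. degree G i = s ! (i - 1))}"

definition forests_with_degrees :: "nat list \<Rightarrow> ugraph set" where
  "forests_with_degrees s = {G \<in> graphs_with_degrees s. forest G}"

definition graphical :: "nat list \<Rightarrow> bool" where
  "graphical s \<longleftrightarrow> graphs_with_degrees s \<noteq> {}"

definition two_switch :: "nat \<Rightarrow> nat \<Rightarrow> nat \<Rightarrow> nat \<Rightarrow> ugraph \<Rightarrow> ugraph" where
  "two_switch a b c d G =
     (if {a, b} \<in> edges G \<and> {c, d} \<in> edges G \<and> {a, b} \<inter> {c, d} = {} \<and>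
         {a, c} \<notin> edges G \<and> {b, d} \<notin> edges G
      then G\<lparr>edges := (edges G - {{a, b}, {c, d}}) \<union> {{a, c}, {b, d}}\<rparr>
      else G)"

text \<open>A graph parameter is an arbitrary function on labeled graphs; invariance under
  isomorphism is not required. Only its values on simple graphs matter.\<close>

definition stable_under_two_switch :: "(ugraph \<Rightarrow> int) \<Rightarrow> bool" where
  "stable_under_two_switch \<xi> \<longleftrightarrow>
     (\<forall>G a b c d. simple_graph G \<longrightarrow> \<bar>\<xi> (two_switch a b c d G) - \<xi> G\<bar> \<le> 1)"

text \<open>The interval may be empty, bounded or unbounded.\<close>

definition interval_property :: "(ugraph \<Rightarrow> int) \<Rightarrow> ugraph set \<Rightarrow> bool" where
  "interval_property \<xi> X \<longleftrightarrow>
     (\<exists>I :: real set. is_interval I \<and> real_of_int ` \<xi> ` X = I \<inter> \<int>)"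

end

theory Submission imports Defs begin

text \<open>Both families are connected under 2-switches that stay inside the family, and an integer
  parameter that changes by at most 1 in each step skips no value along a path of switches.

  Connectivity: given two members \<open>E\<close>, \<open>F\<close> with the same degrees, switch in \<open>E\<close> or in \<open>F\<close> until a
  chosen vertex \<open>v\<close> has the same neighbours in both, delete \<open>v\<close> and use induction. If \<open>vx\<close> is an edge of
  \<open>E\<close> only and \<open>vy\<close> an edge of \<open>F\<close> only, and \<open>x\<close> has at most the degree of \<open>y\<close>, then counting
  neighbours gives \<open>w\<close> such that \<open>vx, yw\<close> can be switched to \<open>vy, xw\<close> in \<open>E\<close>; otherwise the same
  works in \<open>F\<close>. For forests let \<open>v\<close> be a leaf. The switch preserves acyclicity if \<open>w\<close> does not lie
  on the path from \<open>y\<close> to \<open>x\<close>, and such a \<open>w\<close> exists unless \<open>y\<close> is a leaf in the component of \<open>x\<close>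
  in \<open>E\<close>. In that case \<open>vy\<close> is a component of \<open>F\<close> not containing \<open>x\<close>, and one switches in \<open>F\<close>.\<close>

section \<open>Switches on edge sets\<close>

text \<open>The effective case of \<open>two_switch\<close>, as a relation between bare edge sets.
  The vertex set never changes, so it is left out.\<close>

definition switch :: "'a set set \<Rightarrow> 'a set set \<Rightarrow> bool" where
  "switch E E' \<longleftrightarrow> (\<exists>a b c d. {a, b} \<in> E \<and> {c, d} \<in> E \<and> {a, b} \<inter> {c, d} = {} \<and>
     {a, c} \<notin> E \<and> {b, d} \<notin> E \<and> E' = (E - {{a, b}, {c, d}}) \<union> {{a, c}, {b, d}})"

definition switch_in :: "('a set set \<Rightarrow> bool) \<Rightarrow> 'a set set \<Rightarrow> 'a set set \<Rightarrow> bool" where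
  "switch_in P E E' \<longleftrightarrow> switch E E' \<and> P E \<and> P E'"

definition graph_on :: "'a set \<Rightarrow> 'a set set \<Rightarrow> bool" where
  "graph_on V E \<longleftrightarrow> (\<forall>e\<in>E. e \<subseteq> V \<and> card e = 2)"

definition deg :: "'a set set \<Rightarrow> 'a \<Rightarrow> nat" where
  "deg E v = card {e \<in> E. v \<in> e}"

definition nbrs :: "'a set set \<Rightarrow> 'a \<Rightarrow> 'a set" where
  "nbrs E v = {u. {v, u} \<in> E}"

lemma switchI:
  assumes "{a, b} \<in> E" "{c, d} \<in> E" "{a, b} \<inter> {c, d} = {}" "{a, c} \<notin> E" "{b, d} \<notin> E"
  shows "switch E ((E - {{a, b}, {c, d}}) \<union> {{a, c}, {b, d}})"
  unfolding switch_def
  by (rule exI[of _ a], rule exI[of _ b], rule exI[of _ c], rule exI[of _ d]) (use assms in simp)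

lemma graph_on_finite: "finite V \<Longrightarrow> graph_on V E \<Longrightarrow> finite E"
  by (rule finite_subset[of E "Pow V"]) (auto simp: graph_on_def)

lemma graph_on_subset: "graph_on V E \<Longrightarrow> D \<subseteq> E \<Longrightarrow> graph_on V D"
  unfolding graph_on_def by blast

lemma graph_on_edge_neq: "graph_on V E \<Longrightarrow> {a, b} \<in> E \<Longrightarrow> a \<noteq> b"
  by (auto simp: graph_on_def dest!: bspec[of E _ "{a, b}"])

lemma graph_on_edge_in: "graph_on V E \<Longrightarrow> {a, b} \<in> E \<Longrightarrow> a \<in> V \<and> b \<in> V"
  by (auto simp: graph_on_def dest!: bspec[of E _ "{a, b}"])

lemma graph_on_insert: "graph_on V E \<Longrightarrow> a \<in> V \<Longrightarrow> b \<in> V \<Longrightarrow> a \<noteq> b \<Longrightarrow> graph_on V (insert {a, b} E)"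
  unfolding graph_on_def by simp

lemma graph_on_edge_at:
  assumes "graph_on V E" "e \<in> E" "v \<in> e"
  obtains u where "e = {v, u}" "u \<noteq> v"
proof -
  have "card e = 2" using assms by (simp add: graph_on_def)
  then obtain p q where "e = {p, q}" "p \<noteq> q" by (auto simp: card_2_iff)
  with assms(3) that show thesis by (metis insert_commute insert_iff singletonD)
qed

lemma switch_graph_on:
  assumes "switch E E'" "graph_on V E"
  shows "graph_on V E'"
proof -
  obtain a b c d where *: "{a, b} \<in> E" "{c, d} \<in> E" "{a, b} \<inter> {c, d} = {}"
      "E' = (E - {{a, b}, {c, d}}) \<union> {{a, c}, {b, d}}"
    using assms(1) unfolding switch_def by blast
  have "a \<in> V" "b \<in> V" "c \<in> V" "d \<in> V" "a \<noteq> c" "b \<noteq> d"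
    using *(1-3) graph_on_edge_in[OF assms(2)] by auto
  moreover have "graph_on V (E - {{a, b}, {c, d}})"
    using assms(2) graph_on_subset by blast
  ultimately have "graph_on V (insert {a, c} (insert {b, d} (E - {{a, b}, {c, d}})))"
    by (intro graph_on_insert)
  then show ?thesis using * by simp
qed

text \<open>The switch is undone by exchanging the roles of \<open>b\<close> and \<open>c\<close>.
  Absence of loops makes \<open>{a, c}\<close> and \<open>{b, d}\<close> disjoint, as the reverse
  switch requires.\<close>

lemma switch_sym:
  assumes "switch E E'" "graph_on V E"
  shows "switch E' E"
proof -
  obtain a b c d where *: "{a, b} \<in> E" "{c, d} \<in> E" "{a, b} \<inter> {c, d} = {}"
      "{a, c} \<notin> E" "{b, d} \<notin> E" and E': "E' = (E - {{a, b}, {c, d}}) \<union> {{a, c}, {b, d}}"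
    using assms(1) unfolding switch_def by blast
  have ne: "a \<noteq> b" "c \<noteq> d" using * assms(2) graph_on_edge_neq by metis+
  have "switch E' ((E' - {{a, c}, {b, d}}) \<union> {{a, b}, {c, d}})"
    by (rule switchI) (use * ne E' in \<open>auto simp: doubleton_eq_iff\<close>)
  moreover have "(E' - {{a, c}, {b, d}}) \<union> {{a, b}, {c, d}} = E"
    unfolding E' using * by auto
  ultimately show ?thesis by simp
qed

lemma deg_eq_sum: "finite E \<Longrightarrow> deg E v = (\<Sum>e\<in>E. if v \<in> e then 1 else 0)"
  by (simp add: deg_def flip: sum.inter_filter)

lemma switch_deg:
  assumes "switch E E'" "graph_on V E" "finite E"
  shows "deg E' = deg E"
proof
  fix z
  obtain a b c d where *: "{a, b} \<in> E" "{c, d} \<in> E" "{a, b} \<inter> {c, d} = {}"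
      "{a, c} \<notin> E" "{b, d} \<notin> E" and E': "E' = (E - {{a, b}, {c, d}}) \<union> {{a, c}, {b, d}}"
    using assms(1) unfolding switch_def by blast
  have ne: "a \<noteq> b" "c \<noteq> d" using * assms(2) graph_on_edge_neq by metis+
  \<comment> \<open>Each of \<open>a\<close>, \<open>b\<close>, \<open>c\<close>, \<open>d\<close>
    lies on exactly one removed and one added edge; all other edges are in \<open>D\<close>, common
    to both sides.\<close>
  define D where "D = E - {{a, b}, {c, d}}"
  have D: "finite D" "{a, b} \<notin> D" "{c, d} \<notin> D" "{a, c} \<notin> D" "{b, d} \<notin> D"
    using assms(3) * by (auto simp: D_def)
  have E: "E = insert {a, b} (insert {c, d} D)" using * by (auto simp: D_def)
  have E'2: "E' = insert {a, c} (insert {b, d} D)" by (auto simp: E' D_def)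
  have d1: "{a, b} \<noteq> {c, d}" "{a, c} \<noteq> {b, d}" using * ne by (auto simp: doubleton_eq_iff)
  have fin: "finite E" "finite E'" using D E E'2 by auto
  show "deg E' z = deg E z"
    unfolding deg_eq_sum[OF fin(1)] deg_eq_sum[OF fin(2)]
    unfolding E E'2 using D d1 * ne by auto
qed

text \<open>The four pairs involved avoid \<open>v\<close>, so edges at \<open>v\<close> neither
  block the switch nor take part in it. This serves to reattach a deleted star.\<close>

lemma switch_lift:
  assumes "switch D D'" "v \<notin> \<Union>D" "\<forall>e\<in>C. v \<in> e"
  shows "switch (D \<union> C) (D' \<union> C)"
proof -
  obtain a b c d where *: "{a, b} \<in> D" "{c, d} \<in> D" "{a, b} \<inter> {c, d} = {}"
      "{a, c} \<notin> D" "{b, d} \<notin> D" and D': "D' = (D - {{a, b}, {c, d}}) \<union> {{a, c}, {b, d}}"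
    using assms(1) unfolding switch_def by blast
  have v: "v \<noteq> a" "v \<noteq> b" "v \<noteq> c" "v \<noteq> d" using assms(2) * by auto
  then have C: "{a, b} \<notin> C" "{c, d} \<notin> C" "{a, c} \<notin> C" "{b, d} \<notin> C" using assms(3) by auto
  have "switch (D \<union> C) ((D \<union> C - {{a, b}, {c, d}}) \<union> {{a, c}, {b, d}})"
    by (rule switchI) (use * C in auto)
  moreover have "(D \<union> C - {{a, b}, {c, d}}) \<union> {{a, c}, {b, d}} = D' \<union> C"
    unfolding D' using C by auto
  ultimately show ?thesis by simp
qed

lemma switch_Union:
  assumes "switch D D'"
  shows "\<Union>D' \<subseteq> \<Union>D"
proof -
  obtain a b c d where *: "{a, b} \<in> D" "{c, d} \<in> D"
      and D': "D' = (D - {{a, b}, {c, d}}) \<union> {{a, c}, {b, d}}"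
    using assms unfolding switch_def by blast
  have "{a, b} \<subseteq> \<Union>D" "{c, d} \<subseteq> \<Union>D" using * by (simp_all only: Union_upper)
  then show ?thesis unfolding D' by auto
qed

lemma switch_in_path_lift:
  assumes "(switch_in P)\<^sup>*\<^sup>* D D'" "v \<notin> \<Union>D" "\<forall>e\<in>C. v \<in> e"
    and ext: "\<And>D. P D \<Longrightarrow> v \<notin> \<Union>D \<Longrightarrow> P (D \<union> C)"
  shows "(switch_in P)\<^sup>*\<^sup>* (D \<union> C) (D' \<union> C)"
proof -
  have "(switch_in P)\<^sup>*\<^sup>* (D \<union> C) (D' \<union> C) \<and> v \<notin> \<Union>D'"
    using assms(1)
  proof induction
    case base
    then show ?case using assms(2) by simp
  next
    case (step D1 D2)
    then have v: "v \<notin> \<Union>D1" "v \<notin> \<Union>D2"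
      using switch_Union unfolding switch_in_def by blast+
    have "switch_in P (D1 \<union> C) (D2 \<union> C)"
      using step.hyps(2) switch_lift[OF _ v(1) assms(3)] ext v by (simp add: switch_in_def)
    then show ?case using step.IH v by auto
  qed
  then show ?thesis by blast
qed

section \<open>Neighbourhoods and stars of a vertex\<close>

lemma deg_eq_card_nbrs:
  assumes "graph_on V E"
  shows "deg E v = card (nbrs E v)"
proof -
  have "{e \<in> E. v \<in> e} \<subseteq> (\<lambda>u. {v, u}) ` nbrs E v"
  proof
    fix e assume "e \<in> {e \<in> E. v \<in> e}"
    then have e: "e \<in> E" "v \<in> e" by auto
    then obtain u where "e = {v, u}" using graph_on_edge_at[OF assms] by metis
    then show "e \<in> (\<lambda>u. {v, u}) ` nbrs E v" using e by (auto simp: nbrs_def)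
  qed
  then have "{e \<in> E. v \<in> e} = (\<lambda>u. {v, u}) ` nbrs E v"
    by (auto simp: nbrs_def)
  moreover have "inj_on (\<lambda>u. {v, u}) (nbrs E v)"
    by (auto simp: inj_on_def doubleton_eq_iff)
  ultimately show ?thesis unfolding deg_def by (simp add: card_image)
qed

lemma finite_nbrs: "finite V \<Longrightarrow> graph_on V E \<Longrightarrow> finite (nbrs E v)"
  by (rule finite_subset[of _ V]) (auto simp: nbrs_def dest: graph_on_edge_in)

lemma nbrs_sym: "u \<in> nbrs E v \<longleftrightarrow> v \<in> nbrs E u"
  by (simp add: nbrs_def insert_commute)

lemma star_eq_of_nbrs_eq:
  assumes "graph_on V E" "graph_on V F" "nbrs E v = nbrs F v"
  shows "{e \<in> E. v \<in> e} = {e \<in> F. v \<in> e}"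
proof -
  have "e \<in> E \<longleftrightarrow> e \<in> F" if "v \<in> e" for e
    using assms graph_on_edge_at[of V _ e v] that unfolding nbrs_def
    by (metis mem_Collect_eq)
  then show ?thesis by blast
qed

lemma deg_Diff:
  assumes "finite E" "C \<subseteq> E"
  shows "deg (E - C) z = deg E z - deg C z"
proof -
  have "{e \<in> E - C. z \<in> e} = {e \<in> E. z \<in> e} - {e \<in> C. z \<in> e}" by blast
  moreover have "finite {e \<in> C. z \<in> e}" "{e \<in> C. z \<in> e} \<subseteq> {e \<in> E. z \<in> e}"
    using finite_subset[OF assms(2,1)] assms(2) by auto
  ultimately show ?thesis unfolding deg_def by (simp only: card_Diff_subset)
qed

section \<open>Graphs with prescribed degrees\<close>

text \<open>If every neighbour of \<open>y\<close> other than \<open>x\<close> were adjacent to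
  \<open>x\<close>, then \<open>x\<close> would have larger degree than \<open>y\<close>, since
  \<open>v\<close> is adjacent to \<open>x\<close> but not to \<open>y\<close>. An exception
  \<open>w\<close> allows the switch of \<open>vx, yw\<close> to \<open>vy, xw\<close>.\<close>

lemma switch_towards:
  assumes "finite V" "graph_on V E"
    and x: "x \<in> nbrs E v" and y: "y \<notin> nbrs E v" "y \<noteq> v"
    and le: "deg E x \<le> deg E y"
  shows "\<exists>E'. switch E E' \<and> nbrs E' v = insert y (nbrs E v - {x})"
proof -
  have loopless: "u \<notin> nbrs E u" for u
    using graph_on_edge_neq[OF assms(2), of u u] by (auto simp: nbrs_def)
  have vx: "v \<in> nbrs E x" and vy: "v \<notin> nbrs E y" using x y nbrs_sym by metis+
  have fin: "finite (nbrs E u)" for u using finite_nbrs[OF assms(1,2)] .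
  have xy: "x \<noteq> y" using x y by blast
  obtain w where w: "w \<in> nbrs E y" "w \<notin> nbrs E x" "w \<noteq> x"
  proof (rule ccontr)
    assume "\<not> thesis"
    then have "nbrs E y - {x} \<subseteq> nbrs E x" using that by blast
    then have sub: "nbrs E y - {x} \<subseteq> nbrs E x - {v} - {y}" using vy loopless by blast
    have le': "card (nbrs E x) \<le> card (nbrs E y)"
      using le deg_eq_card_nbrs[OF assms(2)] by simp
    have pos: "card (nbrs E x) > 0" using vx fin card_gt_0_iff by blast
    have c: "card (nbrs E y - {x}) \<le> card (nbrs E x - {v} - {y})"
      using sub fin by (intro card_mono) auto
    show False
    \<comment> \<open>If \<open>x\<close> and \<open>y\<close> are adjacent, each side of the
      inclusion loses one more vertex, so the count is contradictory in both cases.\<close>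
    proof (cases "x \<in> nbrs E y")
      case True
      then have "y \<in> nbrs E x - {v}" using nbrs_sym y by fastforce
      moreover have "card (nbrs E x - {v}) = card (nbrs E x) - 1" using vx by simp
      moreover have "card (nbrs E x - {v}) > 0" using calculation(1) fin card_gt_0_iff by blast
      moreover have "card (nbrs E y - {x}) = card (nbrs E y) - 1" using True by simp
      ultimately show False using c le' pos by simp
    next
      case False
      then have "y \<notin> nbrs E x" using nbrs_sym by metis
      then have "nbrs E x - {v} - {y} = nbrs E x - {v}" by blast
      moreover have "card (nbrs E x - {v}) = card (nbrs E x) - 1" using vx by simp
      ultimately show False using c le' pos False by simp
    qed
  qed
  have wv: "w \<noteq> v" using w vx by blast
  have xv: "x \<noteq> v" using vx loopless by blast
  have yw: "y \<noteq> w" using w loopless by blast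
  let ?E' = "(E - {{v, x}, {y, w}}) \<union> {{v, y}, {x, w}}"
  have "switch E ?E'"
    by (rule switchI) (use x y w wv xy in \<open>auto simp: nbrs_def insert_commute\<close>)
  moreover have "nbrs ?E' v = insert y (nbrs E v - {x})"
    using x y w wv xy xv by (auto simp: nbrs_def doubleton_eq_iff)
  ultimately show ?thesis by blast
qed

text \<open>Induction on the number of neighbours of \<open>v\<close> in \<open>E\<close> but not in
  \<open>F\<close>. Equal degrees provide both \<open>x\<close> and \<open>y\<close>, and a switch
  in either graph removes \<open>x\<close> from the difference. Comparing \<open>d x\<close> with
  \<open>d y\<close> decides which graph to switch.\<close>

lemma graph_on_path_align:
  assumes V: "finite V"
    and aligned: "\<And>E F. graph_on V E \<Longrightarrow> graph_on V F \<Longrightarrow> deg E = d \<Longrightarrow> deg F = d \<Longrightarrow>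
      nbrs E v = nbrs F v \<Longrightarrow> (switch_in (graph_on V))\<^sup>*\<^sup>* E F"
    and "graph_on V E" "graph_on V F" "deg E = d" "deg F = d"
  shows "(switch_in (graph_on V))\<^sup>*\<^sup>* E F"
  using assms(3-)
proof (induction "card (nbrs E v - nbrs F v)" arbitrary: E F rule: less_induct)
  case less
  have fin: "finite (nbrs E v)" "finite (nbrs F v)" using finite_nbrs[OF V] less.prems by simp_all
  have ceq: "card (nbrs E v) = card (nbrs F v)"
    using less.prems deg_eq_card_nbrs by metis
  show ?case
  proof (cases "nbrs E v = nbrs F v")
    case True
    then show ?thesis using aligned less.prems by blast
  next
    case False
    then have "\<not> nbrs E v \<subseteq> nbrs F v" "\<not> nbrs F v \<subseteq> nbrs E v"
      using ceq fin card_subset_eq by metis+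
    then obtain x y where x: "x \<in> nbrs E v" "x \<notin> nbrs F v" and y: "y \<in> nbrs F v" "y \<notin> nbrs E v"
      by blast
    have xv: "x \<noteq> v" "y \<noteq> v"
      using x(1) y(1) graph_on_edge_neq less.prems unfolding nbrs_def by fastforce+
    have dec: "card (nbrs E v - nbrs F v - {x}) < card (nbrs E v - nbrs F v)"
      using x fin by (intro card_Diff1_less) auto
    show ?thesis
    proof (cases "d x \<le> d y")
      case True
      then obtain E' where E': "switch E E'" "nbrs E' v = insert y (nbrs E v - {x})"
        using switch_towards[OF V, of E x v y] less.prems x y xv by auto
      have g: "graph_on V E'" "deg E' = d"
        using E' less.prems switch_graph_on switch_deg graph_on_finite[OF V] by metis+
      have "nbrs E' v - nbrs F v = nbrs E v - nbrs F v - {x}" using E' y by auto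
      then have "(switch_in (graph_on V))\<^sup>*\<^sup>* E' F"
        using less.hyps[of E' F] dec g less.prems by simp
      moreover have "switch_in (graph_on V) E E'" using E' g less.prems by (simp add: switch_in_def)
      ultimately show ?thesis by (simp add: converse_rtranclp_into_rtranclp)
    next
      case False
      then obtain F' where F': "switch F F'" "nbrs F' v = insert x (nbrs F v - {y})"
        using switch_towards[OF V, of F y v x] less.prems x y xv by auto
      have g: "graph_on V F'" "deg F' = d"
        using F' less.prems switch_graph_on switch_deg graph_on_finite[OF V] by metis+
      have "nbrs E v - nbrs F' v = nbrs E v - nbrs F v - {x}" using F' y by auto
      then have "(switch_in (graph_on V))\<^sup>*\<^sup>* E F'"
        using less.hyps[of E F'] dec g less.prems by simp
      \<comment> \<open>The switch was made in \<open>F\<close>; reversed, it leads from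
        \<open>F'\<close> back to \<open>F\<close> and completes the path.\<close>
      moreover have "switch_in (graph_on V) F' F"
        using switch_sym F' g less.prems by (auto simp: switch_in_def)
      ultimately show ?thesis by simp
    qed
  qed
qed

section \<open>Induction by deleting a vertex\<close>

lemma deg_eq_0_iff: "finite E \<Longrightarrow> deg E v = 0 \<longleftrightarrow> v \<notin> \<Union>E"
  unfolding deg_def by auto

lemma graph_on_nonempty:
  assumes "graph_on V E" "E \<noteq> {}"
  shows "\<exists>v. v \<in> \<Union>E"
proof -
  obtain e where e: "e \<in> E" using assms(2) by blast
  then have "card e = 2" using assms(1) by (simp add: graph_on_def)
  then have "e \<noteq> {}" by auto
  then show ?thesis using e by blast
qed

lemma empty_of_deg:
  assumes "finite F" "graph_on V F" "deg F = deg {}"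
  shows "F = {}"
proof (rule ccontr)
  assume "F \<noteq> {}"
  then obtain v where "v \<in> \<Union>F" using graph_on_nonempty[OF assms(2)] by blast
  then have "deg F v \<noteq> 0" using deg_eq_0_iff[OF assms(1)] by blast
  then show False using assms(3) by (simp add: deg_def)
qed

text \<open>Induction runs over the sum of the degrees rather than the number of edges because the
  former is visibly the same for the two graphs and unchanged by switches.\<close>

lemma path_delete_star:
  assumes V: "finite V" and P: "\<And>D. P D \<Longrightarrow> graph_on V D"
    and sub: "\<And>D D'. P D \<Longrightarrow> D' \<subseteq> D \<Longrightarrow> P D'"
    and ext: "\<And>D. P D \<Longrightarrow> v \<notin> \<Union>D \<Longrightarrow> P (D \<union> {e \<in> E. v \<in> e})"
    and IH: "\<And>E' F'. P E' \<Longrightarrow> P F' \<Longrightarrow> deg E' = deg F' \<Longrightarrow>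
      (\<Sum>z\<in>V. deg E' z) < (\<Sum>z\<in>V. deg E z) \<Longrightarrow> (switch_in P)\<^sup>*\<^sup>* E' F'"
    and EF: "P E" "P F" "deg E = deg F" "nbrs E v = nbrs F v" and v: "v \<in> \<Union>E"
  shows "(switch_in P)\<^sup>*\<^sup>* E F"
proof -
  define C where "C = {e \<in> E. v \<in> e}"
  \<comment> \<open>The star at \<open>v\<close> is the same in both graphs, so deleting it keeps
    their degrees equal and adding it back restores both.\<close>
  have CF: "C = {e \<in> F. v \<in> e}"
    unfolding C_def by (rule star_eq_of_nbrs_eq[OF P[OF EF(1)] P[OF EF(2)] EF(4)])
  have fin: "finite E" "finite F" using graph_on_finite[OF V] EF P by auto
  have C: "C \<subseteq> E" "C \<subseteq> F" using CF by (auto simp: C_def)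
  have degs: "deg (E - C) = deg (F - C)"
    using deg_Diff[OF fin(1) C(1)] deg_Diff[OF fin(2) C(2)] EF(3) by auto
  have "v \<in> V" using v P[OF EF(1)] by (auto simp: graph_on_def)
  \<comment> \<open>The degree of \<open>v\<close> drops from positive to 0, which makes the degree
    sum strictly smaller.\<close>
  have "deg (E - C) v = 0"
    using deg_eq_0_iff[of "E - C" v] fin by (auto simp: C_def)
  moreover have "deg E v \<noteq> 0" using v deg_eq_0_iff[OF fin(1)] by simp
  ultimately have "deg (E - C) v < deg E v" by simp
  moreover have "deg (E - C) z \<le> deg E z" for z using deg_Diff[OF fin(1) C(1)] by simp
  ultimately have "(\<Sum>z\<in>V. deg (E - C) z) < (\<Sum>z\<in>V. deg E z)"
    using V \<open>v \<in> V\<close> sum_strict_mono_ex1[of V "deg (E - C)" "deg E"] by auto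
  then have "(switch_in P)\<^sup>*\<^sup>* (E - C) (F - C)"
    using IH[of "E - C" "F - C"] sub EF degs by blast
  then have "(switch_in P)\<^sup>*\<^sup>* (E - C \<union> C) (F - C \<union> C)"
    by (rule switch_in_path_lift[where v = v]) (use ext in \<open>auto simp: C_def\<close>)
  moreover have "E - C \<union> C = E" "F - C \<union> C = F" using C by auto
  ultimately show ?thesis by simp
qed

theorem graph_on_path:
  assumes V: "finite V" and "graph_on V E" "graph_on V F" "deg E = deg F"
  shows "(switch_in (graph_on V))\<^sup>*\<^sup>* E F"
  using assms(2-)
proof (induction "\<Sum>z\<in>V. deg E z" arbitrary: E F rule: less_induct)
  case less
  note E = \<open>graph_on V E\<close> and F = \<open>graph_on V F\<close>
  have fin: "finite E" using graph_on_finite[OF V] E by blast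
  show ?case
  proof (cases "E = {}")
    case True
    then have "F = {}" using empty_of_deg[OF graph_on_finite[OF V F] F] less.prems by simp
    then show ?thesis using True by simp
  next
    case False
    then obtain v where v: "v \<in> \<Union>E" using graph_on_nonempty[OF E] by blast
    show ?thesis
    proof (rule graph_on_path_align[where d = "deg E" and v = v, OF V])
      fix E1 F1
      assume 1: "graph_on V E1" "graph_on V F1" "deg E1 = deg E" "deg F1 = deg E"
        "nbrs E1 v = nbrs F1 v"
      have v1: "v \<in> \<Union>E1" using v 1 fin graph_on_finite[OF V 1(1)] deg_eq_0_iff by metis
      show "(switch_in (graph_on V))\<^sup>*\<^sup>* E1 F1"
      proof (rule path_delete_star[where P = "graph_on V" and v = v, OF V])
        fix E' F'
        assume "graph_on V E'" "graph_on V F'" "deg E' = deg F'"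
          "(\<Sum>z\<in>V. deg E' z) < (\<Sum>z\<in>V. deg E1 z)"
        then show "(switch_in (graph_on V))\<^sup>*\<^sup>* E' F'" using less.hyps 1(3) by metis
      next
        fix D assume "graph_on V D"
        then show "graph_on V (D \<union> {e \<in> E1. v \<in> e})" using 1(1) by (simp add: graph_on_def ball_Un)
      qed (use 1 v1 graph_on_subset in \<open>simp_all only:\<close>)
    qed (use E F less.prems in auto)
  qed
qed

section \<open>Forests\<close>

definition conn :: "'a set set \<Rightarrow> 'a \<Rightarrow> 'a \<Rightarrow> bool" where
  "conn E = (\<lambda>p q. {p, q} \<in> E)\<^sup>*\<^sup>*"

text \<open>Every edge is a bridge. This is easier to track than lists of cycle vertices when single
  edges are removed or added; \<open>acyclic_edges_no_cycle\<close> and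
  \<open>no_cycle_acyclic_edges\<close> relate it to cycles.\<close>

definition acyclic_edges :: "'a set set \<Rightarrow> bool" where
  "acyclic_edges E \<longleftrightarrow> (\<forall>p q. {p, q} \<in> E \<longrightarrow> \<not> conn (E - {{p, q}}) p q)"

definition forest_on :: "'a set \<Rightarrow> 'a set set \<Rightarrow> bool" where
  "forest_on V E \<longleftrightarrow> graph_on V E \<and> acyclic_edges E"

lemma conn_refl [simp]: "conn E p p"
  by (simp add: conn_def)

lemma conn_trans: "conn E p q \<Longrightarrow> conn E q r \<Longrightarrow> conn E p r"
  unfolding conn_def by (rule rtranclp_trans)

lemma conn_edge: "{p, q} \<in> E \<Longrightarrow> conn E p q"
  unfolding conn_def by blast

lemma conn_sym: "conn E p q \<Longrightarrow> conn E q p"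
  unfolding conn_def by (rule sympD[OF symp_rtranclp]) (auto simp: symp_def insert_commute)

lemma conn_mono: "conn D p q \<Longrightarrow> D \<subseteq> E \<Longrightarrow> conn E p q"
  unfolding conn_def by (erule rtranclp_mono[THEN predicate2D, rotated]) auto

lemma conn_isolated: "conn E p q \<Longrightarrow> p \<notin> \<Union>E \<Longrightarrow> p = q"
  unfolding conn_def by (erule converse_rtranclpE) auto

text \<open>A walk needs the new edge at most once, from \<open>a\<close> to \<open>b\<close> or
  from \<open>b\<close> to \<open>a\<close>: crossing it back cancels the first crossing.\<close>

lemma conn_insert:
  assumes "conn (insert {a, b} D) p q"
  shows "conn D p q \<or> conn D p a \<and> conn D b q \<or> conn D p b \<and> conn D a q"
  using assms unfolding conn_def[of "insert {a, b} D"]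
proof induction
  case (step q r)
  show ?case
  proof (cases "{q, r} \<in> D")
    case True
    then show ?thesis using step.IH conn_edge conn_trans by metis
  next
    case False
    then have "q = a \<and> r = b \<or> q = b \<and> r = a" using step.hyps(2) by (auto simp: doubleton_eq_iff)
    then show ?thesis using step.IH by auto
  qed
qed simp

lemma acyclic_edges_subset:
  assumes "acyclic_edges E" "D \<subseteq> E"
  shows "acyclic_edges D"
  unfolding acyclic_edges_def
proof (intro allI impI notI)
  fix p q assume "{p, q} \<in> D" "conn (D - {{p, q}}) p q"
  then show False
    using assms conn_mono[of "D - {{p, q}}" p q "E - {{p, q}}"] unfolding acyclic_edges_def by blast
qed

text \<open>The new edge is a bridge by assumption. If an old edge \<open>pq\<close> ceased to be
  one, its bypass would run through \<open>ab\<close>, and the rest of the bypass together with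
  \<open>pq\<close> would already connect \<open>a\<close> and \<open>b\<close> in
  \<open>E\<close>.\<close>

lemma acyclic_edges_insert:
  assumes "acyclic_edges E" "\<not> conn E a b"
  shows "acyclic_edges (insert {a, b} E)"
  unfolding acyclic_edges_def
proof (intro allI impI notI)
  fix p q assume pq: "{p, q} \<in> insert {a, b} E" and c: "conn (insert {a, b} E - {{p, q}}) p q"
  show False
  proof (cases "{p, q} = {a, b}")
    case True
    then have "conn E p q" using c by (elim conn_mono) auto
    then show False using True assms(2) conn_sym by (metis doubleton_eq_iff)
  next
    case False
    let ?D = "E - {{p, q}}"
    have pqE: "{p, q} \<in> E" using False pq by simp
    have "conn (insert {a, b} ?D) p q" using c False by (simp add: insert_Diff_if)
    moreover have "\<not> conn ?D p q" using assms(1) pqE by (simp add: acyclic_edges_def)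
    ultimately have "conn ?D p a \<and> conn ?D b q \<or> conn ?D p b \<and> conn ?D a q"
      using conn_insert by metis
    then have "conn E p a \<and> conn E b q \<or> conn E p b \<and> conn E a q"
      by (meson Diff_subset conn_mono)
    moreover have "conn E p q" using pqE by (rule conn_edge)
    ultimately show False using assms(2) conn_sym conn_trans by metis
  qed
qed

lemma forest_on_graph_on: "forest_on V E \<Longrightarrow> graph_on V E"
  by (simp add: forest_on_def)

lemma forest_on_subset: "forest_on V E \<Longrightarrow> D \<subseteq> E \<Longrightarrow> forest_on V D"
  unfolding forest_on_def using graph_on_subset acyclic_edges_subset by blast

text \<open>The vertex \<open>u\<close> makes the induction work: deleting the edge \<open>uv\<close> leaves \<open>u\<close> outside the
  component of \<open>v\<close>, so a leaf of the rest reached from \<open>v\<close> is still a leaf.\<close>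

lemma forest_leaf:
  assumes "finite V" "forest_on V E" "u \<in> \<Union>E"
  shows "\<exists>w. w \<noteq> u \<and> conn E u w \<and> (\<exists>x. nbrs E w = {x})"
  using graph_on_finite[OF assms(1) forest_on_graph_on[OF assms(2)]] assms(2,3)
proof (induction "card E" arbitrary: E u rule: less_induct)
  case less
  have g: "graph_on V E" using less.prems by (simp add: forest_on_def)
  obtain v where v: "{u, v} \<in> E" "v \<noteq> u"
    using less.prems(3) graph_on_edge_at[OF g] by (metis UnionE)
  let ?D = "E - {{u, v}}"
  have nc: "\<not> conn ?D u v" using less.prems(2) v by (simp add: forest_on_def acyclic_edges_def)
  show ?case
  proof (cases "v \<in> \<Union>?D")
    case False
    have "z = u" if "{v, z} \<in> E" for z
    proof (rule ccontr)
      assume "z \<noteq> u"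
      then have "{v, z} \<in> ?D" using that by (auto simp: doubleton_eq_iff)
      then show False using False by blast
    qed
    then have "nbrs E v = {u}" using v by (auto simp: nbrs_def insert_commute)
    then show ?thesis using v conn_edge by metis
  next
    case True
    have "card ?D < card E" using less.prems(1) v by (intro card_Diff1_less) auto
    then obtain w x where w: "w \<noteq> v" "conn ?D v w" "nbrs ?D w = {x}"
      using less.hyps[of ?D v] less.prems True forest_on_subset[of V E ?D] by auto
    have "w \<noteq> u" using w nc conn_sym by metis
    moreover from this have "nbrs E w = {x}"
      using w by (auto simp: nbrs_def doubleton_eq_iff)
    moreover have "conn E u w" using w(2) v conn_edge conn_trans conn_mono by (metis Diff_subset)
    ultimately show ?thesis by blast
  qed
qed

text \<open>The condition on \<open>w\<close> says that no path from \<open>y\<close> to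
  \<open>x\<close> starts with the edge \<open>yw\<close>. Hence after removal of \<open>yw\<close>
  and \<open>vx\<close> the vertices \<open>x\<close> and \<open>w\<close> lie in different
  components and may be joined, while \<open>v\<close> is isolated and may be attached to
  \<open>y\<close>.\<close>

lemma forest_switch_leaf:
  assumes E: "forest_on V E" and v: "nbrs E v = {x}" and y: "y \<noteq> x" "y \<noteq> v" "y \<in> V"
    and w: "{y, w} \<in> E" "\<not> conn (E - {{y, w}}) w x"
  shows "\<exists>E'. switch E E' \<and> forest_on V E' \<and> nbrs E' v = {y}"
proof -
  have g: "graph_on V E" using E by (rule forest_on_graph_on)
  have vx: "{v, x} \<in> E" and only: "{v, u} \<in> E \<Longrightarrow> u = x" for u using v by (auto simp: nbrs_def)
  have vy: "{v, y} \<notin> E" using only y by blast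
  have wv: "w \<noteq> v" using only w y by (metis insert_commute)
  have wx: "w \<noteq> x" using w conn_refl by metis
  have xw: "{x, w} \<notin> E"
  proof
    assume "{x, w} \<in> E"
    then have "{w, x} \<in> E - {{y, w}}" using y by (auto simp: insert_commute doubleton_eq_iff)
    then show False using w conn_edge by metis
  qed
  have xv: "x \<noteq> v" using graph_on_edge_neq[OF g vx] by simp
  let ?D = "E - {{v, x}, {y, w}}"
  let ?E' = "?D \<union> {{v, y}, {x, w}}"
  have sw: "switch E ?E'"
    by (rule switchI) (use vx vy w xw wv wx xv y in auto)
  have "\<not> conn ?D x w"
  proof
    assume "conn ?D x w"
    then have "conn (E - {{y, w}}) w x" by (rule conn_mono[OF conn_sym]) auto
    then show False using w by simp
  qed
  \<comment> \<open>The edge \<open>xw\<close> is added first: it does not touch \<open>v\<close>,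
    so \<open>vy\<close> then still joins two components.\<close>
  then have 1: "acyclic_edges (insert {x, w} ?D)"
    using E by (intro acyclic_edges_insert) (auto simp: forest_on_def intro: acyclic_edges_subset)
  have "v \<notin> e" if "e \<in> ?D" for e
  proof
    assume "v \<in> e"
    then obtain u where "e = {v, u}" using graph_on_edge_at[OF g, of e v] \<open>e \<in> ?D\<close> by blast
    then show False using only[of u] \<open>e \<in> ?D\<close> by auto
  qed
  then have "v \<notin> \<Union>(insert {x, w} ?D)" using wv xv by auto
  then have "\<not> conn (insert {x, w} ?D) v y" using conn_isolated y by metis
  then have "acyclic_edges (insert {v, y} (insert {x, w} ?D))"
    by (rule acyclic_edges_insert[OF 1])
  then have "acyclic_edges ?E'" by (simp add: insert_commute)
  moreover have "nbrs ?E' v = {y}"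
    using only wv xv y by (auto simp: nbrs_def doubleton_eq_iff)
  ultimately show ?thesis using sw switch_graph_on[OF sw g] by (auto simp: forest_on_def)
qed

text \<open>The path from \<open>y\<close> to \<open>x\<close> leaves \<open>y\<close> along one
  edge only. If both neighbours reached \<open>x\<close> without their edge to \<open>y\<close>,
  there would be a cycle through \<open>y\<close>.\<close>

lemma forest_neighbour_off_path:
  assumes E: "acyclic_edges E" and w: "{y, w1} \<in> E" "{y, w2} \<in> E" "w1 \<noteq> w2"
  shows "\<not> conn (E - {{y, w1}}) w1 x \<or> \<not> conn (E - {{y, w2}}) w2 x"
proof (rule ccontr)
  assume "\<not> ?thesis"
  then have c: "conn (E - {{y, w1}}) w1 x" "conn (E - {{y, w2}}) w2 x" by auto
  define D where "D = E - {{y, w1}, {y, w2}}"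
  have ne: "{y, w1} \<noteq> {y, w2}" using w by (auto simp: doubleton_eq_iff)
  have D1: "E - {{y, w1}} = insert {y, w2} D" and D2: "E - {{y, w2}} = insert {y, w1} D"
    using ne w by (auto simp: D_def)
  have n1: "\<not> conn (insert {y, w2} D) y w1" and n2: "\<not> conn (insert {y, w1} D) y w2"
    using E w D1 D2 unfolding acyclic_edges_def by metis+
  have e: "conn (insert {y, w2} D) y w2" "conn (insert {y, w1} D) y w1"
    by (simp_all add: conn_edge)
  have up: "conn D p q \<Longrightarrow> conn (insert {y, w2} D) p q" "conn D p q \<Longrightarrow> conn (insert {y, w1} D) p q"
    for p q by (auto elim: conn_mono)
  have d: "\<not> conn D y w1" "\<not> conn D y w2" "\<not> conn D w1 w2"
    using n1 n2 e up conn_trans conn_sym by metis+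
  \<comment> \<open>A path from \<open>w1\<close> that uses the edge between \<open>y\<close> and
    \<open>w2\<close> would first reach \<open>y\<close> or \<open>w2\<close> inside
    \<open>D\<close>, which \<open>d\<close> excludes.\<close>
  have "conn D w1 x" using conn_insert[of y w2 D w1 x] c(1) D1 d conn_sym by metis
  moreover have "conn D w2 x" using conn_insert[of y w1 D w2 x] c(2) D2 d conn_sym by metis
  ultimately show False using d conn_sym conn_trans by metis
qed

text \<open>Any edge \<open>yw\<close> will do, since the whole component of \<open>y\<close> is
  disconnected from \<open>x\<close>.\<close>

lemma forest_switch_leaf_other_component:
  assumes E: "forest_on V E" and v: "nbrs E v = {x}" and y: "y \<noteq> v" "y \<in> \<Union>E"
    and nc: "\<not> conn E y x"
  shows "\<exists>E'. switch E E' \<and> forest_on V E' \<and> nbrs E' v = {y}"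
proof -
  have g: "graph_on V E" using E by (rule forest_on_graph_on)
  obtain w where w: "{y, w} \<in> E" using y(2) graph_on_edge_at[OF g] by (metis UnionE)
  then have "\<not> conn (E - {{y, w}}) w x"
    using nc conn_edge conn_trans conn_mono by (metis Diff_subset)
  moreover have "y \<noteq> x" using nc by auto
  ultimately show ?thesis using forest_switch_leaf[OF E v] y w graph_on_edge_in[OF g w] by blast
qed

text \<open>The degree of \<open>y\<close>, common to both graphs, decides. If it is 1, then
  \<open>vy\<close> is a component of \<open>F\<close> that misses \<open>x\<close>, and the switch
  is made in \<open>F\<close>. Otherwise \<open>y\<close> has two neighbours in \<open>E\<close>, at
  least one of them off the path to \<open>x\<close>.\<close>

lemma forest_switch_align_leaf:
  assumes V: "finite V" and E: "forest_on V E" and F: "forest_on V F" and d: "deg E = deg F"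
    and x: "nbrs E v = {x}" and y: "nbrs F v = {y}" and xy: "x \<noteq> y"
  shows "(\<exists>E'. switch E E' \<and> forest_on V E' \<and> nbrs E' v = {y}) \<or>
         (\<exists>F'. switch F F' \<and> forest_on V F' \<and> nbrs F' v = {x})"
proof -
  have g: "graph_on V E" "graph_on V F" using E F forest_on_graph_on by auto
  have fin: "finite E" "finite F" using graph_on_finite[OF V] g by auto
  have edges: "{v, x} \<in> E" "{v, y} \<in> F" using x y by (auto simp: nbrs_def)
  have xv: "x \<noteq> v" "y \<noteq> v" using edges g graph_on_edge_neq by fastforce+
  have xE: "x \<in> \<Union>E" and yF: "y \<in> \<Union>F" using edges by auto
  then have xF: "x \<in> \<Union>F" and yE: "y \<in> \<Union>E" using d deg_eq_0_iff fin by metis+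
  show ?thesis
  proof (cases "deg F y = 1")
    case True
    then have "card (nbrs F y) = 1" using deg_eq_card_nbrs[OF g(2)] by simp
    moreover have "v \<in> nbrs F y" using edges by (simp add: nbrs_def insert_commute)
    ultimately have ny: "nbrs F y = {v}" by (metis card_1_singletonE singletonD)
    \<comment> \<open>The set \<open>{v, y}\<close> is closed under adjacency in \<open>F\<close>,
      so it contains the component of \<open>y\<close>.\<close>
    have "z \<in> {v, y}" if "conn F y z" for z
      using that unfolding conn_def
    proof induction
      case (step p q)
      then have "q \<in> nbrs F p" "p \<in> {v, y}" by (auto simp: nbrs_def)
      then show ?case using ny y by auto
    qed simp
    then have "\<not> conn F x y" using xv xy conn_sym by fastforce
    then show ?thesis using forest_switch_leaf_other_component[OF F y xv(1) xF] by blast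
  next
    case False
    have "card (nbrs E y) \<noteq> 1" "card (nbrs E y) \<noteq> 0"
      using False d deg_eq_card_nbrs[OF g(1)] deg_eq_0_iff[OF fin(1)] yE by auto
    then obtain w1 w2 where w: "w1 \<in> nbrs E y" "w2 \<in> nbrs E y" "w1 \<noteq> w2"
      by (metis card.empty card_1_singleton_iff is_singletonI' is_singleton_altdef)
    then have e: "{y, w1} \<in> E" "{y, w2} \<in> E" by (auto simp: nbrs_def)
    then obtain w where "{y, w} \<in> E" "\<not> conn (E - {{y, w}}) w x"
      using forest_neighbour_off_path[of E y w1 w2 x] w E by (auto simp: forest_on_def)
    then show ?thesis
      using forest_switch_leaf[OF E x] xy xv graph_on_edge_in[OF g(1)] by metis
  qed
qed

lemma forest_on_add_leaf:
  assumes "forest_on V D" "v \<notin> \<Union>D" "v \<in> V" "x \<in> V" "x \<noteq> v"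
  shows "forest_on V (insert {v, x} D)"
  using assms conn_isolated[of D v x] acyclic_edges_insert[of D v x] graph_on_insert[of V D v x]
  unfolding forest_on_def by blast

text \<open>By equality of degrees a leaf \<open>v\<close> of \<open>E\<close> is a leaf of
  \<open>F\<close>, so at most one switch aligns its neighbours. Its star is a single edge, whose
  reattachment keeps a forest.\<close>

theorem forest_on_path:
  assumes V: "finite V" and "forest_on V E" "forest_on V F" "deg E = deg F"
  shows "(switch_in (forest_on V))\<^sup>*\<^sup>* E F"
  using assms(2-)
proof (induction "\<Sum>z\<in>V. deg E z" arbitrary: E F rule: less_induct)
  case less
  note E = \<open>forest_on V E\<close> and F = \<open>forest_on V F\<close> and d = \<open>deg E = deg F\<close>
  have g: "graph_on V E" "graph_on V F" using E F forest_on_graph_on by auto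
  have fin: "finite E" "finite F" using graph_on_finite[OF V] g by auto
  show ?case
  proof (cases "E = {}")
    case True
    then show ?thesis using empty_of_deg[OF fin(2) g(2)] d by simp
  next
    case False
    then obtain u where "u \<in> \<Union>E" using graph_on_nonempty[OF g(1)] by blast
    then obtain v x where x: "nbrs E v = {x}" using forest_leaf[OF V E] by blast
    have "card (nbrs F v) = 1" using x d deg_eq_card_nbrs g by (metis is_singletonI is_singleton_altdef)
    then obtain y where y: "nbrs F v = {y}" by (metis card_1_singletonE)
    \<comment> \<open>Stated for general \<open>E1\<close> and \<open>F1\<close>, because the
      aligning switch may replace either graph.\<close>
    have aligned: "(switch_in (forest_on V))\<^sup>*\<^sup>* E1 F1"
      if 1: "forest_on V E1" "forest_on V F1" "deg E1 = deg E" "deg F1 = deg E"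
        "nbrs E1 v = {z}" "nbrs F1 v = {z}" for E1 F1 z
    proof -
      have g1: "graph_on V E1" using 1 forest_on_graph_on by auto
      have vz: "{v, z} \<in> E1" using 1 by (auto simp: nbrs_def)
      then have zV: "v \<in> V" "z \<in> V" "z \<noteq> v"
        using graph_on_edge_in[OF g1 vz] graph_on_edge_neq[OF g1 vz] by simp_all
      have star: "{e \<in> E1. v \<in> e} = {{v, z}}"
      proof -
        have "e = {v, z}" if e: "e \<in> E1" "v \<in> e" for e
        proof -
          obtain u where u: "e = {v, u}" using graph_on_edge_at[OF g1 e] .
          then have "u \<in> nbrs E1 v" using e by (simp add: nbrs_def)
          then show ?thesis using u 1(5) by simp
        qed
        then have "{e \<in> E1. v \<in> e} \<subseteq> {{v, z}}" by blast
        moreover have "{v, z} \<in> {e \<in> E1. v \<in> e}" using vz by simp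
        ultimately show ?thesis by blast
      qed
      show ?thesis
      proof (rule path_delete_star[where P = "forest_on V" and v = v, OF V])
        fix E' F'
        assume "forest_on V E'" "forest_on V F'" "deg E' = deg F'"
          "(\<Sum>z\<in>V. deg E' z) < (\<Sum>z\<in>V. deg E1 z)"
        then show "(switch_in (forest_on V))\<^sup>*\<^sup>* E' F'" using less.hyps 1(3) by metis
      next
        fix D assume "forest_on V D" "v \<notin> \<Union>D"
        then show "forest_on V (D \<union> {e \<in> E1. v \<in> e})"
          using forest_on_add_leaf zV by (simp add: star)
      next
        show "v \<in> \<Union>E1" using vz by blast
      qed (use 1 forest_on_graph_on forest_on_subset in \<open>simp_all only:\<close>)
    qed
    show ?thesis
    proof (cases "x = y")
      case True
      then show ?thesis using aligned[OF E F refl d[symmetric] x] y by simp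
    next
      case False
      then consider E' where "switch E E'" "forest_on V E'" "nbrs E' v = {y}"
        | F' where "switch F F'" "forest_on V F'" "nbrs F' v = {x}"
        using forest_switch_align_leaf[OF V E F d x y] by blast
      then show ?thesis
      proof cases
        case 1
        have "(switch_in (forest_on V))\<^sup>*\<^sup>* E' F"
          using aligned[OF 1(2) F switch_deg[OF 1(1) g(1) fin(1)] d[symmetric] 1(3) y] .
        moreover have "switch_in (forest_on V) E E'" using 1 E by (simp add: switch_in_def)
        ultimately show ?thesis by (simp add: converse_rtranclp_into_rtranclp)
      next
        case 2
        have "(switch_in (forest_on V))\<^sup>*\<^sup>* E F'"
          using aligned[OF E 2(2) refl _ x 2(3)] switch_deg[OF 2(1) g(2) fin(2)] d by metis
        moreover have "switch_in (forest_on V) F' F"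
          using 2 F switch_sym[OF 2(1) g(2)] by (simp add: switch_in_def)
        ultimately show ?thesis by simp
      qed
    qed
  qed
qed

section \<open>Bridges and the absence of cycles\<close>

lemma acyclic_edges_no_cycle:
  assumes "acyclic_edges (edges G)"
  shows "\<not> is_cycle G vs"
proof
  assume cyc: "is_cycle G vs"
  let ?n = "length vs"
  have n: "?n \<ge> 3" "distinct vs"
    and step: "\<And>i. i < ?n \<Longrightarrow> {vs ! i, vs ! (Suc i mod ?n)} \<in> edges G"
    using cyc unfolding is_cycle_def by auto
  \<comment> \<open>The closing edge of the cycle, from the last index, where
    \<open>Suc i mod ?n\<close> is 0. The other edges connect its ends, so it is no bridge.\<close>
  let ?e = "{vs ! 0, vs ! (?n - 1)}"
  have e: "?e \<in> edges G" using step[of "?n - 1"] n(1) by (cases vs) (simp_all add: insert_commute)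
  have "conn (edges G - {?e}) (vs ! 0) (vs ! i)" if "i < ?n" for i
    using that
  proof (induction i)
    case (Suc i)
    have "{vs ! i, vs ! Suc i} \<in> edges G" using step[of i] Suc.prems by simp
    \<comment> \<open>Coincidence would force \<open>i = 0\<close> and
      \<open>Suc i = ?n - 1\<close>, hence length 2.\<close>
    moreover have "{vs ! i, vs ! Suc i} \<noteq> ?e"
    proof
      assume *: "{vs ! i, vs ! Suc i} = ?e"
      have "vs ! Suc i \<noteq> vs ! 0" using n Suc.prems nth_eq_iff_index_eq[OF n(2), of "Suc i" 0] by linarith
      then have eq: "vs ! i = vs ! 0" "vs ! Suc i = vs ! (?n - 1)"
        using * by (auto simp: doubleton_eq_iff)
      have lt: "i < ?n" "0 < ?n" "?n - 1 < ?n" using n Suc.prems by linarith+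
      have "i = 0" using nth_eq_iff_index_eq[OF n(2) lt(1,2)] eq(1) by simp
      moreover have "Suc i = ?n - 1"
        using nth_eq_iff_index_eq[OF n(2) Suc.prems lt(3)] eq(2) by simp
      ultimately have "?n = 2" using lt by simp
      then show False using n by simp
    qed
    ultimately have "conn (edges G - {?e}) (vs ! i) (vs ! Suc i)" by (intro conn_edge) simp
    moreover have "conn (edges G - {?e}) (vs ! 0) (vs ! i)" using Suc by simp
    ultimately show ?case by (rule conn_trans[rotated])
  qed simp
  then have "conn (edges G - {?e}) (vs ! 0) (vs ! (?n - 1))" using n by simp
  then show False using assms e by (simp add: acyclic_edges_def)
qed

text \<open>The path grows along the walk; when the walk returns to a vertex of the path, the path
  is cut back to end there.\<close>

lemma conn_distinct_path:
  assumes "conn D u v"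
  shows "\<exists>vs. vs \<noteq> [] \<and> distinct vs \<and> vs ! 0 = u \<and> last vs = v \<and>
    (\<forall>i. Suc i < length vs \<longrightarrow> {vs ! i, vs ! Suc i} \<in> D)"
  using assms unfolding conn_def
proof induction
  case base
  show ?case by (rule exI[of _ "[u]"]) simp
next
  case (step q r)
  then obtain vs where vs: "vs \<noteq> []" "distinct vs" "vs ! 0 = u" "last vs = q"
    "\<And>i. Suc i < length vs \<Longrightarrow> {vs ! i, vs ! Suc i} \<in> D" by blast
  show ?case
  proof (cases "r \<in> set vs")
    case True
    then obtain j where j: "j < length vs" "vs ! j = r" by (metis in_set_conv_nth)
    then have "last (take (Suc j) vs) = r" by (simp add: take_Suc_conv_app_nth)
    then show ?thesis
      by (intro exI[of _ "take (Suc j) vs"]) (use vs j in auto)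
  next
    case False
    have "{(vs @ [r]) ! i, (vs @ [r]) ! Suc i} \<in> D" if "Suc i < length (vs @ [r])" for i
    proof (cases "Suc i < length vs")
      case True
      then show ?thesis using vs(5) by (simp add: nth_append)
    next
      case False
      then have "Suc i = length vs" using that by simp
      then have "i < length vs" "(vs @ [r]) ! Suc i = r" "vs ! i = q"
        using vs(1,4) by (auto simp: last_conv_nth nth_append simp flip: \<open>Suc i = length vs\<close>)
      then show ?thesis using step.hyps(2) by (simp add: nth_append)
    qed
    then show ?thesis
      by (intro exI[of _ "vs @ [r]"]) (use vs False in \<open>auto simp: nth_append\<close>)
  qed
qed

lemma no_cycle_acyclic_edges:
  assumes G: "graph_on V (edges G)" and nc: "\<nexists>vs. is_cycle G vs"
  shows "acyclic_edges (edges G)"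
  unfolding acyclic_edges_def
proof (intro allI impI notI)
  fix p q assume pq: "{p, q} \<in> edges G" and "conn (edges G - {{p, q}}) p q"
  then obtain vs where vs: "vs \<noteq> []" "distinct vs" "vs ! 0 = p" "last vs = q"
    and step: "\<And>i. Suc i < length vs \<Longrightarrow> {vs ! i, vs ! Suc i} \<in> edges G - {{p, q}}"
    using conn_distinct_path by metis
  have lst: "vs ! (length vs - 1) = q" using vs by (simp add: last_conv_nth)
  have "p \<noteq> q" using graph_on_edge_neq[OF G pq] .
  \<comment> \<open>Length 1 would mean \<open>p = q\<close>, and length 2 would use the excluded
    edge \<open>pq\<close>. From length 3 on, \<open>pq\<close> closes the path to a cycle.\<close>
  then have "length vs \<noteq> 1" using lst vs by auto
  moreover have "length vs \<noteq> 2" using step[of 0] lst vs by auto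
  ultimately have len: "length vs \<ge> 3" using vs(1) by (cases "length vs") auto
  have "{vs ! i, vs ! (Suc i mod length vs)} \<in> edges G" if "i < length vs" for i
  proof (cases "Suc i = length vs")
    case True
    then have "i = length vs - 1" by simp
    then show ?thesis using True lst vs(3) pq by (simp add: insert_commute)
  next
    case False
    then show ?thesis using that step[of i] by simp
  qed
  then have "is_cycle G vs" using len vs by (simp add: is_cycle_def)
  then show False using nc by blast
qed

section \<open>The interval property\<close>

text \<open>A step from a value below \<open>k\<close> to one at least \<open>k\<close> lands
  exactly on \<open>k\<close>, as it rises by at most 1.\<close>

lemma discrete_ivt:
  fixes f :: "'a \<Rightarrow> int"
  assumes "R\<^sup>*\<^sup>* x y" "\<And>u v. R u v \<Longrightarrow> \<bar>f v - f u\<bar> \<le> 1" "\<And>u v. R u v \<Longrightarrow> v \<in> X" "x \<in> X"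
    and "f x \<le> k" "k \<le> f y"
  shows "\<exists>z\<in>X. f z = k"
  using assms(1,6)
proof induction
  case base
  then show ?case using assms by force
next
  case (step y z)
  show ?case
  proof (cases "k \<le> f y")
    case False
    then have "f z = k" using assms(2)[OF step.hyps(2)] step.prems by linarith
    then show ?thesis using assms(3)[OF step.hyps(2)] by blast
  qed (use step.IH in blast)
qed

lemma interval_propertyI:
  assumes "\<And>G H k. G \<in> X \<Longrightarrow> H \<in> X \<Longrightarrow> \<xi> G \<le> k \<Longrightarrow> k \<le> \<xi> H \<Longrightarrow> k \<in> \<xi> ` X"
  shows "interval_property \<xi> X"
proof -
  \<comment> \<open>The reals between two attained values. This covers empty families and unbounded
    sets of values alike.\<close>
  define I where "I = {r. \<exists>G\<in>X. \<exists>H\<in>X. real_of_int (\<xi> G) \<le> r \<and> r \<le> real_of_int (\<xi> H)}"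
  have "is_interval I"
    unfolding is_interval_1 I_def by clarsimp (meson order_trans)
  moreover have "real_of_int ` \<xi> ` X = I \<inter> \<int>"
  proof
    show "real_of_int ` \<xi> ` X \<subseteq> I \<inter> \<int>" by (auto simp: I_def)
    show "I \<inter> \<int> \<subseteq> real_of_int ` \<xi> ` X"
      using assms by (auto simp: I_def elim!: Ints_cases)
  qed
  ultimately show ?thesis unfolding interval_property_def by blast
qed

text \<open>The argument common to both families: \<open>P\<close> will be \<open>graph_on V\<close>
  or \<open>forest_on V\<close>.\<close>

lemma interval_property_of_path:
  assumes st: "stable_under_two_switch \<xi>" and V: "finite V"
    and P: "\<And>E. P E \<Longrightarrow> graph_on V E"
    and X: "X = {G. verts G = V \<and> P (edges G) \<and> (\<forall>i\<in>V. deg (edges G) i = d i)}"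
    and path: "\<And>E F. P E \<Longrightarrow> P F \<Longrightarrow> deg E = deg F \<Longrightarrow> (switch_in P)\<^sup>*\<^sup>* E F"
  shows "interval_property \<xi> X"
proof (rule interval_propertyI)
  fix G H k
  assume GH: "G \<in> X" "H \<in> X" and k: "\<xi> G \<le> k" "k \<le> \<xi> H"
  define mk where "mk E = \<lparr>verts = V, edges = E\<rparr>" for E
  have mk: "mk (edges K) = K" if "K \<in> X" for K using that by (simp add: mk_def X)
  have PGH: "P (edges G)" "P (edges H)" using GH by (auto simp: X)
  have degs: "deg (edges G) = deg (edges H)"
  proof
    fix i
    \<comment> \<open>Degrees are prescribed on \<open>V\<close> only. Elsewhere they vanish, so the
      degree functions agree everywhere, as \<open>path\<close> requires.\<close>
    have "deg E i = 0" if "i \<notin> V" "P E" for E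
    proof -
      have "{e \<in> E. i \<in> e} = {}" using that P[of E] by (auto simp: graph_on_def)
      then show ?thesis unfolding deg_def by (simp only: card.empty)
    qed
    then show "deg (edges G) i = deg (edges H) i"
      using GH PGH by (cases "i \<in> V") (auto simp: X)
  qed
  let ?S = "{E. P E \<and> deg E = deg (edges G)}"
  have "(switch_in P)\<^sup>*\<^sup>* (edges G) (edges H)" using path PGH degs by blast
  \<comment> \<open>Recording along the path that degrees are preserved ensures that every edge set
    on it yields a graph in \<open>X\<close>.\<close>
  then have "(\<lambda>E E'. switch_in P E E' \<and> E \<in> ?S \<and> E' \<in> ?S)\<^sup>*\<^sup>* (edges G) (edges H) \<and> edges H \<in> ?S"
  proof induction
    case base
    then show ?case using PGH by simp
  next
    case (step E E')
    then have "E' \<in> ?S"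
      using switch_deg[of E E' V] P graph_on_finite[OF V] by (auto simp: switch_in_def)
    then show ?case using step by (auto intro: rtranclp.rtrancl_into_rtrancl)
  qed
  then have "\<exists>E\<in>?S. \<xi> (mk E) = k"
  proof (intro discrete_ivt[where f = "\<lambda>E. \<xi> (mk E)"], elim conjE)
    fix E E' assume *: "switch_in P E E' \<and> E \<in> ?S \<and> E' \<in> ?S"
    then obtain a b c d where "{a, b} \<in> E" "{c, d} \<in> E" "{a, b} \<inter> {c, d} = {}"
        "{a, c} \<notin> E" "{b, d} \<notin> E" "E' = (E - {{a, b}, {c, d}}) \<union> {{a, c}, {b, d}}"
      unfolding switch_in_def switch_def by blast
    then have "mk E' = two_switch a b c d (mk E)" by (simp add: two_switch_def mk_def)
    moreover have "simple_graph (mk E)"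
      using * P V by (auto simp: simple_graph_def mk_def graph_on_def)
    ultimately show "\<bar>\<xi> (mk E') - \<xi> (mk E)\<bar> \<le> 1"
      using st by (simp add: stable_under_two_switch_def)
  qed (use PGH k mk GH in auto)
  then obtain E where E: "P E" "deg E = deg (edges G)" "\<xi> (mk E) = k" by auto
  then have "mk E \<in> X" using GH(1) by (simp add: X mk_def)
  then show "k \<in> \<xi> ` X" using E by blast
qed

theorem theorem8:
  fixes s :: "nat list" and \<xi> :: "ugraph \<Rightarrow> int"
  assumes "graphical s"
    and "stable_under_two_switch \<xi>"
  shows "interval_property \<xi> (graphs_with_degrees s) \<and>
         interval_property \<xi> (forests_with_degrees s)"
proof -
  let ?V = "{1..length s}" and ?d = "\<lambda>i. s ! (i - 1)"
  have G: "graphs_with_degrees s =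
      {G. verts G = ?V \<and> graph_on ?V (edges G) \<and> (\<forall>i\<in>?V. deg (edges G) i = ?d i)}"
    by (auto simp: graphs_with_degrees_def simple_graph_def graph_on_def degree_def deg_def)
  have forest_iff: "forest K \<longleftrightarrow> acyclic_edges (edges K)" if "K \<in> graphs_with_degrees s" for K
    using that no_cycle_acyclic_edges[of ?V K] acyclic_edges_no_cycle[of K] G
    by (auto simp: forest_def graphs_with_degrees_def)
  have F: "forests_with_degrees s =
      {G. verts G = ?V \<and> forest_on ?V (edges G) \<and> (\<forall>i\<in>?V. deg (edges G) i = ?d i)}"
    using forest_iff by (auto simp: forests_with_degrees_def forest_on_def G)
  have "interval_property \<xi> (graphs_with_degrees s)"
    by (rule interval_property_of_path[OF assms(2) _ _ G]) (auto intro: graph_on_path)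
  moreover have "interval_property \<xi> (forests_with_degrees s)"
    by (rule interval_property_of_path[OF assms(2) _ _ F])
      (auto intro: forest_on_path forest_on_graph_on)
  ultimately show ?thesis by blast
qed

end
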